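(* Let $d\ge2$. The map $$(\Theta_{\mathbb{L}^d})^2\ni(\theta,\theta')\mapsto\left([\theta,\theta],[\theta',\theta'],[\theta,\theta']\right)\in(\mathbb{R}_{>0})^2\times\mathbb{R}$$ is a maximal invariant for the action of $\mathrm{SO}_0(1,d)$ on $(\Theta_{\mathbb{L}^d})^2$ defined by $(A,(\theta,\theta'))\mapsto(A\theta,A\theta')$.
   Context: The Minkowski inner product on $\mathbb{R}^{d+1}$ is $[(x_0,\dots,x_d),(y_0,\dots,y_d)]=x_0y_0-x_1y_1-\cdots-x_dy_d$. $\mathbb{L}^d=\{x\in\mathbb{R}^{d+1}:x_0=\sqrt{1+x_1^2+\cdots+x_d^2}\}$ and $\Theta_{\mathbb{L}^d}=\{\theta\in\mathbb{R}^{d+1}:\theta_0>\sqrt{\theta_1^2+\cdots+\theta_d^2}\}$. $\mathrm{SO}(1,d)=\{A\in\mathrm{SL}(d+1,\mathbb{R}):[Ax,Ay]=[x,y]\ \forall x,y\in\mathbb{R}^{d+1}\}$ and $\mathrm{SO}_0(1,d)=\{A\in\mathrm{SO}(1,d):A(\mathbb{L}^d)=\mathbb{L}^d\}$; it acts on $\Theta_{\mathbb{L}^d}$ by matrix multiplication on column vectors. For a group $G$ acting on a set $X$, a map $\varphi:X\to Y$ is called a maximal invariant if $\varphi(gx)=\varphi(x)$ for all $g\in G$, $x\in X$, and whenever $\varphi(x_1)=\varphi(x_2)$ there exists $g\in G$ with $x_2=gx_1$. *)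

theory Defs
  imports "HOL-Analysis.Analysis" "HOL-Algebra.Group_Action"
begin

text \<open>
  The space of dimension \<open>d + 1\<close> is \<^typ>\<open>real ^ 'd option\<close> with \<open>d = CARD('d)\<close>: the index
  \<^term>\<open>None\<close> is the time coordinate \<open>x\<^sub>0\<close> and the indices \<^term>\<open>Some i\<close> are the
  space coordinates \<open>x\<^sub>1, \<dots>, x\<^sub>d\<close>.
\<close>

definition minkowski :: "real ^ 'd::finite option \<Rightarrow> real ^ 'd option \<Rightarrow> real" where
  "minkowski x y = x $ None * y $ None - (\<Sum>i\<in>UNIV. x $ Some i * y $ Some i)"

definition hyperboloid :: "(real ^ 'd::finite option) set" where
  "hyperboloid = {x. x $ None = sqrt (1 + (\<Sum>i\<in>UNIV. (x $ Some i)\<^sup>2))}"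

definition Theta :: "(real ^ 'd::finite option) set" where
  "Theta = {x. x $ None > sqrt (\<Sum>i\<in>UNIV. (x $ Some i)\<^sup>2)}"

definition SL :: "(real ^ 'n::finite ^ 'n) set" where
  "SL = {A. det A = 1}"

definition SO :: "(real ^ 'd::finite option ^ 'd option) set" where
  "SO = {A \<in> SL. \<forall>x y. minkowski (A *v x) (A *v y) = minkowski x y}"

definition SO0 :: "(real ^ 'd::finite option ^ 'd option) monoid" where
  "SO0 = \<lparr>carrier = {A \<in> SO. (\<lambda>x. A *v x) ` hyperboloid = hyperboloid},
          mult = (**), one = mat 1\<rparr>"

text \<open>
  \<^const>\<open>group_action\<close> requires the maps \<open>act g\<close> to be undefined outside \<open>X\<close>, hence the
  restriction. The set \<open>Y\<close> is the codomain of \<open>\<phi>\<close>.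
\<close>

definition maximal_invariant ::
    "('g, 'm) monoid_scheme \<Rightarrow> 'a set \<Rightarrow> ('g \<Rightarrow> 'a \<Rightarrow> 'a) \<Rightarrow> 'b set \<Rightarrow> ('a \<Rightarrow> 'b) \<Rightarrow> bool" where
  "maximal_invariant G X act Y \<phi> \<longleftrightarrow>
     group_action G X (\<lambda>g. restrict (act g) X) \<and>
     \<phi> \<in> X \<rightarrow> Y \<and>
     (\<forall>g\<in>carrier G. \<forall>x\<in>X. \<phi> (act g x) = \<phi> x) \<and>
     (\<forall>x\<^sub>1\<in>X. \<forall>x\<^sub>2\<in>X. \<phi> x\<^sub>1 = \<phi> x\<^sub>2 \<longrightarrow> (\<exists>g\<in>carrier G. x\<^sub>2 = act g x\<^sub>1))"

end

theory Submission
  imports Defs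
begin

text \<open>
  A nonzero vector that is orthogonal to a timelike vector is spacelike, so the reflection in it is
  defined. If \<open>x\<close> and \<open>y\<close> in \<^const>\<open>Theta\<close> have the same norm, then \<open>x - y\<close> is orthogonal to
  \<open>x + y\<close>, and the reflection in it maps \<open>x\<close> to \<open>y\<close>; it fixes every vector that has the same
  product with \<open>x\<close> and \<open>y\<close>. Hence two reflections suffice to map one pair to another pair with
  the same invariants. Since \<open>d + 1 \<ge> 3\<close>, there is a reflection that fixes both vectors of a pair,
  and it corrects the sign of the determinant. A linear isometry that maps one vector of
  \<^const>\<open>Theta\<close> into \<^const>\<open>Theta\<close> preserves the hyperboloid.
\<close>

section \<open>Minkowski space\<close>

text \<open>Splitting off the time coordinate makes the Euclidean norm and Cauchy-Schwarz
  available.\<close>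

definition space_part :: "real ^ 'd::finite option \<Rightarrow> real ^ 'd" where
  "space_part x = (\<chi> i. x $ Some i)"

lemma space_part_simps [simp]:
  "space_part (x + y) = space_part x + space_part y"
  "space_part (x - y) = space_part x - space_part y"
  "space_part (- x) = - space_part x"
  "space_part (c *\<^sub>R x) = c *\<^sub>R space_part x"
  "space_part 0 = 0"
  by (simp_all add: space_part_def vec_eq_iff)

lemma eq_0_iff_space_part: "x = 0 \<longleftrightarrow> x $ None = 0 \<and> space_part x = 0"
  by (auto simp: space_part_def vec_eq_iff split_option_all)

lemma sum_space_part: "(\<Sum>i\<in>UNIV. (x $ Some i)\<^sup>2) = (norm (space_part x))\<^sup>2"
  unfolding power2_norm_eq_inner by (simp add: space_part_def inner_vec_def power2_eq_square)

lemma minkowski_eq_inner: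
  "minkowski x y = x $ None * y $ None - space_part x \<bullet> space_part y"
  by (simp add: minkowski_def space_part_def inner_vec_def)

lemma minkowski_self: "minkowski x x = (x $ None)\<^sup>2 - (norm (space_part x))\<^sup>2"
  unfolding power2_norm_eq_inner by (simp add: minkowski_eq_inner power2_eq_square)

lemma minkowski_commute: "minkowski x y = minkowski y x"
  by (simp add: minkowski_eq_inner inner_commute mult.commute)

lemma minkowski_linear [simp]:
  "minkowski (x + y) z = minkowski x z + minkowski y z"
  "minkowski (x - y) z = minkowski x z - minkowski y z"
  "minkowski (- x) z = - minkowski x z"
  "minkowski (c *\<^sub>R x) z = c * minkowski x z"
  "minkowski z (x + y) = minkowski z x + minkowski z y"
  "minkowski z (x - y) = minkowski z x - minkowski z y"
  "minkowski z (- x) = - minkowski z x"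
  "minkowski z (c *\<^sub>R x) = c * minkowski z x"
  by (simp_all add: minkowski_eq_inner algebra_simps)

section \<open>The cone of future timelike vectors\<close>

lemma mem_Theta_iff: "x \<in> Theta \<longleftrightarrow> norm (space_part x) < x $ None"
  by (simp add: Theta_def sum_space_part)

lemma Theta_add: "x \<in> Theta \<Longrightarrow> y \<in> Theta \<Longrightarrow> x + y \<in> Theta"
  using norm_triangle_ineq[of "space_part x" "space_part y"] by (simp add: mem_Theta_iff)

lemma Theta_scaleR: "x \<in> Theta \<Longrightarrow> 0 < c \<Longrightarrow> c *\<^sub>R x \<in> Theta"
  by (simp add: mem_Theta_iff)

text \<open>A positive square makes the time coordinate exceed the space norm in absolute value; its
  sign selects the cone.\<close>

lemma mem_Theta_or_uminus_iff:
  "x \<in> Theta \<or> - x \<in> Theta \<longleftrightarrow> 0 < minkowski x x"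
proof -
  have "0 < minkowski x x \<longleftrightarrow> norm (space_part x) < \<bar>x $ None\<bar>"
    using abs_le_square_iff[of "x $ None" "norm (space_part x)"]
    by (simp add: minkowski_self linorder_not_le[symmetric])
  then show ?thesis
    by (auto simp: mem_Theta_iff)
qed

lemma minkowski_pos_Theta: "x \<in> Theta \<Longrightarrow> 0 < minkowski x x"
  using mem_Theta_or_uminus_iff by blast

text \<open>Cauchy-Schwarz bounds the space product, and each space norm lies strictly below the
  time coordinate.\<close>

lemma minkowski_Theta_pos:
  assumes "x \<in> Theta" "y \<in> Theta"
  shows "0 < minkowski x y"
proof -
  have "space_part x \<bullet> space_part y \<le> norm (space_part x) * norm (space_part y)"
    by (rule norm_cauchy_schwarz)
  also have "\<dots> < x $ None * y $ None"
    using assms by (intro mult_strict_mono) (auto simp: mem_Theta_iff intro: le_less_trans[OF norm_ge_zero])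
  finally show ?thesis
    by (simp add: minkowski_eq_inner)
qed

text \<open>Otherwise \<open>- x\<close> would lie in the cone, forcing a negative product of
  \<open>x\<close> with \<open>t\<close>. Membership can thus be read off from products, which
  isometries preserve.\<close>

lemma Theta_if_minkowski_pos:
  assumes "0 < minkowski x x" "t \<in> Theta" "0 < minkowski x t"
  shows "x \<in> Theta"
  using assms mem_Theta_or_uminus_iff[of x] minkowski_Theta_pos[of "- x" t] by auto

lemma orthogonal_Theta_spacelike:
  assumes "t \<in> Theta" "minkowski v t = 0" "v \<noteq> 0"
  shows "minkowski v v < 0"
proof -
  have t: "norm (space_part t) < t $ None" "0 < t $ None"
    using assms(1) le_less_trans[OF norm_ge_zero] by (auto simp: mem_Theta_iff)
  have eq: "v $ None * t $ None = space_part v \<bullet> space_part t"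
    using assms(2) by (simp add: minkowski_eq_inner)
  \<comment> \<open>A zero space part would force \<open>v = 0\<close>; being nonzero, it keeps the
    Cauchy-Schwarz estimate below strict.\<close>
  with t assms(3) have "space_part v \<noteq> 0"
    by (auto simp: eq_0_iff_space_part)
  have "\<bar>v $ None\<bar> * t $ None = \<bar>space_part v \<bullet> space_part t\<bar>"
    using t by (simp flip: eq add: abs_mult)
  also have "\<dots> \<le> norm (space_part v) * norm (space_part t)"
    by (rule Cauchy_Schwarz_ineq2)
  also have "\<dots> < norm (space_part v) * t $ None"
    using t \<open>space_part v \<noteq> 0\<close> by simp
  finally have "\<bar>v $ None\<bar> < \<bar>norm (space_part v)\<bar>"
    using t by simp
  then have "(v $ None)\<^sup>2 < (norm (space_part v))\<^sup>2"
    by (rule power2_strict_mono)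
  then show ?thesis
    by (simp add: minkowski_self)
qed

lemma mem_hyperboloid_iff: "x \<in> hyperboloid \<longleftrightarrow> x \<in> Theta \<and> minkowski x x = 1"
proof
  assume "x \<in> hyperboloid"
  then have x: "x $ None = sqrt (1 + (norm (space_part x))\<^sup>2)"
    by (simp add: hyperboloid_def sum_space_part)
  then have "norm (space_part x) < x $ None"
    by (simp add: real_less_rsqrt)
  with x show "x \<in> Theta \<and> minkowski x x = 1"
    by (simp add: mem_Theta_iff minkowski_self)
next
  assume x: "x \<in> Theta \<and> minkowski x x = 1"
  then have "0 \<le> x $ None"
    by (auto simp: mem_Theta_iff intro: order.trans[OF norm_ge_zero less_imp_le])
  with x show "x \<in> hyperboloid"
    by (auto simp: hyperboloid_def sum_space_part minkowski_self algebra_simps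
        intro!: real_sqrt_unique[symmetric])
qed

text \<open>Every ray of the cone meets the hyperboloid, which transfers the defining condition of
  \<open>SO0\<close> to \<open>Theta\<close>.\<close>

lemma Theta_eq_scaleR_hyperboloid:
  assumes "x \<in> Theta"
  obtains c y where "0 < c" "y \<in> hyperboloid" "x = c *\<^sub>R y"
proof
  let ?c = "sqrt (minkowski x x)"
  have pos: "0 < minkowski x x"
    using assms by (rule minkowski_pos_Theta)
  then show "0 < ?c" "x = ?c *\<^sub>R ((1 / ?c) *\<^sub>R x)"
    by auto
  with pos assms show "(1 / ?c) *\<^sub>R x \<in> hyperboloid"
    by (auto simp: mem_hyperboloid_iff Theta_scaleR)
qed

section \<open>The group and its action\<close>

text \<open>There is no determinant condition, so that reflections are included.\<close>

definition lorentz :: "real ^ 'd::finite option ^ 'd option \<Rightarrow> bool" where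
  "lorentz A \<longleftrightarrow> (\<forall>x y. minkowski (A *v x) (A *v y) = minkowski x y)"

lemma lorentzD: "lorentz A \<Longrightarrow> minkowski (A *v x) (A *v y) = minkowski x y"
  by (simp add: lorentz_def)

lemma lorentz_mult: "lorentz A \<Longrightarrow> lorentz B \<Longrightarrow> lorentz (A ** B)"
  by (simp add: lorentz_def flip: matrix_vector_mul_assoc)

lemma lorentz_mat_1: "lorentz (mat 1)"
  by (simp add: lorentz_def)

lemma lorentz_inverse:
  assumes "lorentz A" "A ** B = mat 1"
  shows "lorentz B"
  unfolding lorentz_def
proof (intro allI)
  fix x y
  have "minkowski (A *v (B *v x)) (A *v (B *v y)) = minkowski (B *v x) (B *v y)"
    using assms(1) by (rule lorentzD)
  with assms(2) show "minkowski (B *v x) (B *v y) = minkowski x y"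
    by (simp add: matrix_vector_mul_assoc)
qed

text \<open>The vector \<open>t\<close> decides the side for all: the product of
  \<open>A *v x\<close> with \<open>A *v t\<close> equals that of \<open>x\<close> with
  \<open>t\<close>, hence is positive.\<close>

lemma lorentz_Theta:
  assumes "lorentz A" "t \<in> Theta" "A *v t \<in> Theta" "x \<in> Theta"
  shows "A *v x \<in> Theta"
proof (rule Theta_if_minkowski_pos[OF _ assms(3)])
  show "0 < minkowski (A *v x) (A *v x)" "0 < minkowski (A *v x) (A *v t)"
    using assms by (simp_all only: lorentzD minkowski_Theta_pos)
qed

lemma mem_carrier_SO0_iff:
  "A \<in> carrier SO0 \<longleftrightarrow> lorentz A \<and> det A = 1 \<and> (\<lambda>x. A *v x) ` hyperboloid = hyperboloid"
  by (auto simp: SO0_def SO_def SL_def lorentz_def)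

lemma det_1_inverse:
  fixes A :: "real ^ 'n ^ 'n"
  assumes "det A = 1"
  obtains B where "A ** B = mat 1" "B ** A = mat 1" "det B = 1"
proof -
  obtain B where "A ** B = mat 1" "B ** A = mat 1"
    using assms invertible_det_nz[of A] by (auto simp: invertible_def)
  then show thesis
    using that[of B] assms det_mul[of A B] by simp
qed

lemma SO0_inverse:
  assumes "A \<in> carrier SO0"
  obtains B where "B \<in> carrier SO0" "A ** B = mat 1" "B ** A = mat 1"
proof -
  from assms have A: "lorentz A" "det A = 1" "(\<lambda>x. A *v x) ` hyperboloid = hyperboloid"
    by (auto simp: mem_carrier_SO0_iff)
  then obtain B where B: "A ** B = mat 1" "B ** A = mat 1" "det B = 1"
    using det_1_inverse by blast
  have "(\<lambda>x. B *v x) ` hyperboloid = (\<lambda>x. B *v x) ` (\<lambda>x. A *v x) ` hyperboloid"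
    using A by simp
  also have "\<dots> = hyperboloid"
    using B by (simp add: image_image matrix_vector_mul_assoc)
  finally show thesis
    using that[of B] A B lorentz_inverse[OF A(1) B(1)] by (simp add: mem_carrier_SO0_iff)
qed

lemma SO0_Theta:
  assumes "A \<in> carrier SO0" "x \<in> Theta"
  shows "A *v x \<in> Theta"
proof -
  obtain c y where "0 < c" "y \<in> hyperboloid" "x = c *\<^sub>R y"
    using assms(2) by (rule Theta_eq_scaleR_hyperboloid)
  moreover from this have "A *v y \<in> Theta"
    using assms(1) by (auto simp: mem_carrier_SO0_iff mem_hyperboloid_iff)
  ultimately show ?thesis
    by (simp add: Theta_scaleR matrix_vector_mult_scaleR)
qed

text \<open>The condition on the whole hyperboloid reduces to a single test vector; the inverse
  supplies surjectivity.\<close>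

lemma mem_carrier_SO0I:
  assumes "lorentz A" "det A = 1" "t \<in> Theta" "A *v t \<in> Theta"
  shows "A \<in> carrier SO0"
proof -
  obtain B where B: "A ** B = mat 1" "B ** A = mat 1"
    using assms(2) det_1_inverse by blast
  have "lorentz B"
    using assms(1) B(1) by (rule lorentz_inverse)
  \<comment> \<open>\<open>A *v t\<close> serves as the test vector for \<open>B\<close>.\<close>
  have "B *v (A *v t) \<in> Theta"
    using B assms by (simp add: matrix_vector_mul_assoc)
  have "A *v x \<in> hyperboloid" if "x \<in> hyperboloid" for x
    using that assms lorentz_Theta by (auto simp: mem_hyperboloid_iff lorentzD)
  moreover have "B *v x \<in> hyperboloid" if "x \<in> hyperboloid" for x
    using that \<open>lorentz B\<close> lorentz_Theta[OF \<open>lorentz B\<close> assms(4) \<open>B *v (A *v t) \<in> Theta\<close>]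
    by (auto simp: mem_hyperboloid_iff lorentzD)
  moreover have "A *v (B *v x) = x" for x
    using B by (simp add: matrix_vector_mul_assoc)
  ultimately have "(\<lambda>x. A *v x) ` hyperboloid = hyperboloid"
    unfolding set_eq_iff image_iff by metis
  with assms show ?thesis
    by (simp add: mem_carrier_SO0_iff)
qed

lemma mult_SO0 [simp]: "mult SO0 = (**)" and one_SO0 [simp]: "one SO0 = mat 1"
  by (simp_all add: SO0_def)

lemma group_SO0: "group (SO0 :: (real ^ 'd::finite option ^ 'd option) monoid)"
proof (rule groupI)
  fix A B :: "real ^ 'd::finite option ^ 'd option"
  assume "A \<in> carrier SO0" "B \<in> carrier SO0"
  moreover have "(\<lambda>x. (A ** B) *v x) ` H = (\<lambda>x. A *v x) ` (\<lambda>x. B *v x) ` H" for H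
    by (simp add: image_image matrix_vector_mul_assoc)
  ultimately show "A \<otimes>\<^bsub>SO0\<^esub> B \<in> carrier SO0"
    by (simp add: mem_carrier_SO0_iff lorentz_mult det_mul)
next
  fix A :: "real ^ 'd::finite option ^ 'd option"
  assume "A \<in> carrier SO0"
  then show "\<exists>B\<in>carrier SO0. B \<otimes>\<^bsub>SO0\<^esub> A = \<one>\<^bsub>SO0\<^esub>"
    using SO0_inverse by (metis mult_SO0 one_SO0)
qed (auto simp: matrix_mul_assoc mem_carrier_SO0_iff lorentz_mat_1)

lemma group_action_SO0_pairs:
  "group_action SO0 (Theta \<times> Theta)
     (\<lambda>A. restrict ((\<lambda>(\<theta>, \<theta>'). (A *v \<theta>, A *v \<theta>'))) (Theta \<times> Theta))"
  (is "group_action SO0 ?X ?act")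
proof -
  have maps: "?act A x \<in> ?X" if "A \<in> carrier SO0" "x \<in> ?X" for A x
    using that SO0_Theta by auto
  have "bij_betw (?act A) ?X ?X" if A: "A \<in> carrier SO0" for A
  proof -
    obtain B where B: "B \<in> carrier SO0" "A ** B = mat 1" "B ** A = mat 1"
      using A by (rule SO0_inverse)
    show ?thesis
    proof (rule bij_betwI)
      show "?act A \<in> ?X \<rightarrow> ?X" "?act B \<in> ?X \<rightarrow> ?X"
        using maps A B by auto
      show "?act B (?act A x) = x" if "x \<in> ?X" for x
        using that A B SO0_Theta by (auto simp: matrix_vector_mul_assoc)
      show "?act A (?act B x) = x" if "x \<in> ?X" for x
        using that A B SO0_Theta by (auto simp: matrix_vector_mul_assoc)
    qed
  qed
  \<comment> \<open>Since \<open>B\<close> maps the cone into itself, the restriction in the map of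
    \<open>A\<close> is inactive on its values.\<close>
  moreover have "?act (A ** B) = compose ?X (?act A) (?act B)" if "B \<in> carrier SO0" for A B
    using maps[OF that] by (intro ext) (auto simp: compose_def matrix_vector_mul_assoc SO0_Theta that)
  ultimately show ?thesis
    unfolding group_action_def group_hom_def group_hom_axioms_def
    by (intro conjI group_SO0 group_BijGroup homI) (auto simp: BijGroup_def Bij_def)
qed

section \<open>Reflections\<close>

definition outer :: "real ^ 'n \<Rightarrow> real ^ 'n \<Rightarrow> real ^ 'n ^ 'n" where
  "outer u w = (\<chi> a b. u $ a * w $ b)"

lemma outer_mult_vector: "outer u w *v x = (w \<bullet> x) *\<^sub>R u"
  by (simp add: outer_def matrix_vector_mult_def inner_vec_def vec_eq_iff sum_distrib_left
      sum_distrib_right mult_ac)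

text \<open>
  If \<open>P\<close> is the identity matrix with column \<open>i\<close> replaced by \<open>u\<close>, then \<open>(1 + u w\<^sup>T) P = P Q\<close>, where
  \<open>Q\<close> differs from the identity matrix only in row \<open>i\<close>.
\<close>
lemma det_mat_1_plus_outer:
  fixes u w :: "real ^ 'n"
  shows "det (mat 1 + outer u w) = 1 + w \<bullet> u"
proof (cases "u = 0")
  case True
  then have "outer u w = 0"
    by (simp add: outer_def vec_eq_iff)
  with True show ?thesis
    by simp
next
  case False
  \<comment> \<open>This entry will be the determinant of \<open>P\<close>, which is cancelled at
    the end.\<close>
  then obtain i where i: "u $ i \<noteq> 0"
    by (auto simp: vec_eq_iff)
  \<comment> \<open>Row \<open>i\<close> of \<open>Q\<close> holds the coefficients of
    \<open>u\<close> in the columns of the product: column \<open>i\<close> is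
    \<open>(1 + w \<bullet> u) u\<close>, any other column \<open>j\<close> is the unit vector
    \<open>e_j\<close> plus \<open>w_j u\<close>.\<close>
  define r where "r = (\<chi> j. if j = i then 1 + w \<bullet> u else w $ j)"
  define P :: "real ^ 'n ^ 'n" where "P = (\<chi> a j. if j = i then u $ a else mat 1 $ a $ j)"
  define Q :: "real ^ 'n ^ 'n" where "Q = (\<chi> a j. if a = i then r $ j else mat 1 $ a $ j)"
  \<comment> \<open>Cramer's rule for the identity matrix; it gives \<open>det P\<close> directly
    and \<open>det Q\<close> by transposition.\<close>
  have det_column: "det (\<chi> a j. if j = i then v $ a else mat 1 $ a $ j) = v $ i"
    for v :: "real ^ 'n"
    using cramer_lemma[of i "mat 1" v] unfolding matrix_vector_mul_lid by simp
  then have P: "det P = u $ i"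
    unfolding P_def .
  have "Q = transpose (\<chi> a j. if j = i then r $ a else mat 1 $ a $ j)"
    by (simp add: Q_def transpose_def vec_eq_iff mat_def)
  then have Q: "det Q = 1 + w \<bullet> u"
    using det_column[of r] by (simp add: r_def)
  have wu: "(\<Sum>k\<in>UNIV. w $ k * u $ k) = w \<bullet> u"
    by (simp add: inner_vec_def)
  have distrib: "(mat 1 + outer u w) ** P = mat 1 ** P + outer u w ** P"
    by (vector matrix_matrix_mult_def sum.distrib[symmetric] distrib_right)
  have "(outer u w ** P) $ a $ j = u $ a * (if j = i then w \<bullet> u else w $ j)" for a j
  proof -
    have "(outer u w ** P) $ a $ j
        = (\<Sum>k\<in>UNIV. u $ a * (if j = i then w $ k * u $ k else if k = j then w $ k else 0))"
      unfolding matrix_matrix_mult_def vec_lambda_beta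
      by (rule sum.cong) (auto simp: outer_def P_def mat_def)
    then show ?thesis
      by (simp add: wu flip: sum_distrib_left)
  qed
  moreover have "(P ** Q) $ a $ j
      = u $ a * r $ j + (if a = j \<and> a \<noteq> i then 1 else 0)" for a j
  proof -
    have "(P ** Q) $ a $ j = (\<Sum>k\<in>UNIV. (if k = i then u $ a * r $ j else 0)
        + (if k = a then if a = j \<and> a \<noteq> i then 1 else 0 else 0))"
      unfolding matrix_matrix_mult_def vec_lambda_beta
      by (rule sum.cong) (auto simp: P_def Q_def mat_def)
    then show ?thesis
      by (simp add: sum.distrib)
  qed
  ultimately have "(mat 1 + outer u w) ** P = P ** Q"
    unfolding distrib matrix_mul_lid
    by (auto simp: vec_eq_iff P_def r_def mat_def algebra_simps)
  then have "det (mat 1 + outer u w) * det P = det P * det Q"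
    by (metis det_mul)
  with P Q i show ?thesis
    by simp
qed

text \<open>Turns Minkowski products into Euclidean ones, for use in the determinant formula and in
  Euclidean orthogonal complements.\<close>

definition minkowski_dual :: "real ^ 'd::finite option \<Rightarrow> real ^ 'd option" where
  "minkowski_dual x = (\<chi> k. if k = None then x $ k else - x $ k)"

lemma inner_minkowski_dual: "minkowski_dual x \<bullet> y = minkowski x y"
  by (simp add: minkowski_dual_def minkowski_def inner_vec_def UNIV_option_conv sum.reindex
      sum_negf)

text \<open>Written as a rank-one update of the identity, so that
  \<open>det_mat_1_plus_outer\<close> yields its determinant.\<close>

definition reflection :: "real ^ 'd::finite option \<Rightarrow> real ^ 'd option ^ 'd option" where
  "reflection v = mat 1 + outer v ((- 2 / minkowski v v) *\<^sub>R minkowski_dual v)"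

lemma reflection_apply:
  "reflection v *v x = x - (2 * minkowski v x / minkowski v v) *\<^sub>R v"
  by (simp add: reflection_def matrix_vector_mult_add_rdistrib outer_mult_vector
      inner_minkowski_dual)

lemma det_reflection: "minkowski v v \<noteq> 0 \<Longrightarrow> det (reflection v) = - 1"
  by (simp add: reflection_def det_mat_1_plus_outer inner_minkowski_dual)

lemma lorentz_reflection:
  assumes "minkowski v v \<noteq> 0"
  shows "lorentz (reflection v)"
  unfolding lorentz_def
proof (intro allI)
  fix x y
  define a where "a = 2 * minkowski v x / minkowski v v"
  define b where "b = 2 * minkowski v y / minkowski v v"
  \<comment> \<open>With these values the two cross terms cancel against the term
    \<open>a * b * minkowski v v\<close>.\<close>
  have x: "minkowski x v = a * minkowski v v / 2" and y: "minkowski v y = b * minkowski v v / 2"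
    using assms by (simp_all add: a_def b_def minkowski_commute[of x v])
  have "minkowski (reflection v *v x) (reflection v *v y)
      = minkowski (x - a *\<^sub>R v) (y - b *\<^sub>R v)"
    by (simp only: reflection_apply a_def b_def)
  also have "\<dots> = minkowski x y"
    by (simp add: x y algebra_simps)
  finally show "minkowski (reflection v *v x) (reflection v *v y) = minkowski x y" .
qed

lemma reflection_fixes: "minkowski v x = 0 \<Longrightarrow> reflection v *v x = x"
  by (simp add: reflection_apply)

text \<open>Equal norms make the coefficient of \<open>x - y\<close> in the reflection equal to
  1.\<close>

lemma reflection_swaps:
  assumes "minkowski x x = minkowski y y" "minkowski (x - y) (x - y) \<noteq> 0"
  shows "reflection (x - y) *v x = y"
proof -
  have "2 * minkowski (x - y) x = minkowski (x - y) (x - y)"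
    using assms(1) by (simp add: minkowski_commute[of y x])
  with assms(2) show ?thesis
    by (simp add: reflection_apply)
qed

section \<open>Transitivity on pairs with equal invariants\<close>

lemma lorentz_exchange:
  fixes x y :: "real ^ 'd::finite option"
  assumes "t \<in> Theta" "minkowski (x - y) t = 0" "minkowski x x = minkowski y y"
  obtains A where "lorentz A" "\<bar>det A\<bar> = 1" "A *v x = y"
    "\<And>z. minkowski x z = minkowski y z \<Longrightarrow> A *v z = z"
proof (cases "x = y")
  case True
  then show thesis
    using that[of "mat 1"] lorentz_mat_1 by simp
next
  case False
  then have "minkowski (x - y) (x - y) \<noteq> 0"
    using orthogonal_Theta_spacelike[OF assms(1,2)] by simp
  then show thesis
    using that[of "reflection (x - y)"] assms(3)
    by (simp add: lorentz_reflection det_reflection reflection_swaps reflection_fixes)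
qed

text \<open>Two dual vectors cannot span a space of dimension at least 3; orthogonality to the
  timelike \<open>x\<close> then makes \<open>v\<close> spacelike.\<close>

lemma exists_spacelike_orthogonal:
  fixes x y :: "real ^ 'd::finite option"
  assumes "2 \<le> CARD('d)" "x \<in> Theta"
  obtains v where "minkowski v x = 0" "minkowski v y = 0" "minkowski v v < 0"
proof -
  let ?S = "{minkowski_dual x, minkowski_dual y}"
  have "card ?S \<le> 2"
    by (simp add: card_insert_if)
  then have "dim ?S < DIM(real ^ 'd option)"
    using dim_le_card[of ?S ?S] assms(1) by (simp add: span_superset)
  then obtain v where v: "v \<noteq> 0" "\<And>z. z \<in> span ?S \<Longrightarrow> orthogonal v z"
    using orthogonal_to_subspace_exists by blast
  have "minkowski v z = 0" if "minkowski_dual z \<in> ?S" for z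
    using v(2)[OF span_base[OF that]]
    by (simp add: orthogonal_def inner_commute[of v] inner_minkowski_dual minkowski_commute)
  then show thesis
    using that v(1) orthogonal_Theta_spacelike[OF assms(2)] by blast
qed

lemma SO0_transitive_on_pairs:
  fixes x x' y y' :: "real ^ 'd::finite option"
  assumes "2 \<le> CARD('d)"
    and Theta: "x \<in> Theta" "y \<in> Theta"
    and eq: "minkowski x x = minkowski y y" "minkowski x' x' = minkowski y' y'"
      "minkowski x x' = minkowski y y'"
  obtains A where "A \<in> carrier SO0" "A *v x = y" "A *v x' = y'"
proof -
  \<comment> \<open>The first exchange uses \<open>x + y\<close>, again in the cone, as its timelike
    vector.\<close>
  have "minkowski (x - y) (x + y) = 0"
    using eq(1) by (simp add: minkowski_commute[of y x])
  from lorentz_exchange[OF Theta_add[OF Theta] this eq(1)]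
  obtain A where A: "lorentz A" "\<bar>det A\<bar> = 1" "A *v x = y"
    by metis
  have "minkowski y (A *v x') = minkowski y y'"
    using lorentzD[OF A(1), of x x'] A(3) eq(3) by simp
  \<comment> \<open>This both lets \<open>y\<close> be the timelike vector of the second exchange
    and ensures that \<open>B\<close> fixes \<open>y\<close>.\<close>
  then have orth: "minkowski (A *v x') y = minkowski y' y"
    by (simp add: minkowski_commute)
  then have "minkowski (A *v x' - y') y = 0"
    by simp
  moreover have "minkowski (A *v x') (A *v x') = minkowski y' y'"
    using A(1) eq(2) by (simp add: lorentzD)
  ultimately obtain B where B: "lorentz B" "\<bar>det B\<bar> = 1" "B *v (A *v x') = y'"
    "B *v y = y"
    using lorentz_exchange[OF Theta(2)] orth by metis
  define C where "C = B ** A"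
  have C: "lorentz C" "\<bar>det C\<bar> = 1" "C *v x = y" "C *v x' = y'"
    using A B by (simp_all add: C_def lorentz_mult det_mul abs_mult flip: matrix_vector_mul_assoc)
  obtain v where v: "minkowski v y = 0" "minkowski v y' = 0" "minkowski v v < 0"
    using assms(1) Theta(2) by (rule exists_spacelike_orthogonal)
  have "\<exists>D. lorentz D \<and> det D = 1 \<and> D *v x = y \<and> D *v x' = y'"
  proof (cases "det C = 1")
    case True
    with C show ?thesis
      by blast
  next
    case False
    with C(2) have "det C = - 1"
      by simp
    \<comment> \<open>Reflecting in \<open>v\<close> after \<open>C\<close> fixes the targets
      \<open>y\<close> and \<open>y'\<close> and turns the determinant into 1.\<close>
    with C v show ?thesis
      by (intro exI[of _ "reflection v ** C"])
        (simp add: lorentz_mult lorentz_reflection det_mul det_reflection reflection_fixes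
          flip: matrix_vector_mul_assoc)
  qed
  \<comment> \<open>The test vector is \<open>x\<close>, which is sent to \<open>y\<close> in the
    cone.\<close>
  then show thesis
    using that mem_carrier_SO0I Theta by metis
qed

theorem proposition7:
  assumes "CARD('d::finite) \<ge> 2"
  shows "maximal_invariant
           (SO0 :: (real ^ 'd option ^ 'd option) monoid)
           (Theta \<times> Theta)
           (\<lambda>A (\<theta>, \<theta>'). (A *v \<theta>, A *v \<theta>'))
           ({0<..} \<times> {0<..} \<times> UNIV)
           (\<lambda>(\<theta>, \<theta>'). (minkowski \<theta> \<theta>, minkowski \<theta>' \<theta>', minkowski \<theta> \<theta>'))"
  unfolding maximal_invariant_def
proof (intro conjI ballI impI)
  show "group_action SO0 (Theta \<times> Theta)
     (\<lambda>A :: real ^ 'd option ^ 'd option.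
        restrict (\<lambda>(\<theta>, \<theta>'). (A *v \<theta>, A *v \<theta>')) (Theta \<times> Theta))"
    by (rule group_action_SO0_pairs)
next
  fix p q :: "(real ^ 'd option) \<times> (real ^ 'd option)"
  assume "p \<in> Theta \<times> Theta" "q \<in> Theta \<times> Theta"
    and "(\<lambda>(\<theta>, \<theta>'). (minkowski \<theta> \<theta>, minkowski \<theta>' \<theta>', minkowski \<theta> \<theta>')) p =
      (\<lambda>(\<theta>, \<theta>'). (minkowski \<theta> \<theta>, minkowski \<theta>' \<theta>', minkowski \<theta> \<theta>')) q"
  moreover obtain x x' y y' where "p = (x, x')" "q = (y, y')"
    by fastforce
  ultimately show "\<exists>A\<in>carrier SO0. q = (\<lambda>(\<theta>, \<theta>'). (A *v \<theta>, A *v \<theta>')) p"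
    using SO0_transitive_on_pairs[OF assms, of x y x' y'] by auto
next
  fix A :: "real ^ 'd option ^ 'd option" and p :: "(real ^ 'd option) \<times> (real ^ 'd option)"
  assume "A \<in> carrier SO0"
  then have "lorentz A"
    by (simp add: mem_carrier_SO0_iff)
  then show "(\<lambda>(\<theta>, \<theta>'). (minkowski \<theta> \<theta>, minkowski \<theta>' \<theta>', minkowski \<theta> \<theta>'))
      ((\<lambda>(\<theta>, \<theta>'). (A *v \<theta>, A *v \<theta>')) p) =
    (\<lambda>(\<theta>, \<theta>'). (minkowski \<theta> \<theta>, minkowski \<theta>' \<theta>', minkowski \<theta> \<theta>')) p"
    by (simp add: lorentzD split_beta)
\<comment> \<open>What remains is that the values lie in the codomain.\<close>
qed (auto simp: minkowski_pos_Theta)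

end
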